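(* For $n\geq 1$ let $\mu(n)$ denote the degree of the variant $\mathcal T_n^a$ where $a\in\mathcal T_n$ has rank $1$. For any real number $1<x<2$ there exists $N\in\mathbb N$ such that $\mu(n)\leq xn$ for all $n>N$. Consequently $\mu(n)\sim n$ as $n\to\infty$.
   Context: $\mathcal T_n$ is the full transformation semigroup on $\{1,\dots,n\}$; the rank of a transformation is the size of its image. The variant $\mathcal T_n^a$ is the set $\mathcal T_n$ with operation $f\star g=fag$. The degree of a finite semigroup $S$ is the least $m\geq1$ such that $S$ embeds in $\mathcal T_m$. The degree of $\mathcal T_n^a$ does not depend on the choice of the rank-$1$ map $a$. *)

theory Defs
  imports "HOL-Algebra.Group" "HOL-Library.Landau_Symbols"
begin

text \<open>Maps act on the right: the product \<open>f g\<close> means first \<open>f\<close>, then \<open>g\<close>.\<close>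

definition full_transf :: "nat \<Rightarrow> (nat \<Rightarrow> nat) monoid" where
  "full_transf n =
    \<lparr>carrier = {1..n} \<rightarrow>\<^sub>E {1..n},
     monoid.mult = (\<lambda>f g. compose {1..n} g f),
     one = restrict id {1..n}\<rparr>"

definition transf_rank :: "nat \<Rightarrow> (nat \<Rightarrow> nat) \<Rightarrow> nat" where
  "transf_rank n f = card (f ` {1..n})"

text \<open>
  A variant is only a semigroup. Its \<open>one\<close> field is left over from \<^const>\<open>full_transf\<close>,
  has no meaning, and is not looked at by \<^const>\<open>hom\<close> and \<^const>\<open>mon\<close>.
\<close>

definition variant :: "nat \<Rightarrow> (nat \<Rightarrow> nat) \<Rightarrow> (nat \<Rightarrow> nat) monoid" where
  "variant n a = (full_transf n)
    \<lparr>monoid.mult := (\<lambda>f g. f \<otimes>\<^bsub>full_transf n\<^esub> a \<otimes>\<^bsub>full_transf n\<^esub> g)\<rparr>"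

text \<open>
  The degree is meaningful for finite semigroups, for which a suitable \<open>m\<close> exists.
\<close>

definition semigroup_degree :: "('a, 'b) monoid_scheme \<Rightarrow> nat" where
  "semigroup_degree S = (LEAST m. 1 \<le> m \<and> mon S (full_transf m) \<noteq> {})"

end

theory Submission
  imports Defs "HOL-Real_Asymp.Real_Asymp"
begin

text \<open>
  If \<open>a\<close> is constant with value \<open>c\<close>, then \<open>f \<star> g\<close> is the constant map with value \<open>g c\<close>. Split
  \<open>k + u + v\<close> points into blocks \<open>A, U, V\<close> of these sizes, and let \<open>g\<close> act as a constant into \<open>A\<close>
  on \<open>A\<close>, as a constant into \<open>U\<close> on \<open>U\<close>, and as some map \<open>V \<rightarrow> U\<close> on \<open>V\<close>. The two constants
  record \<open>g c\<close>, for which \<open>n \<le> k u\<close> is enough, and the map on \<open>V\<close> separates the \<open>n ^ (n - 1)\<close>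
  maps \<open>g\<close> with the same value \<open>g c\<close>, for which \<open>n ^ (n - 1) \<le> u ^ v\<close> is enough. For fixed \<open>k\<close> one
  can take \<open>u\<close> close to \<open>n / k\<close> and \<open>v\<close> close to \<open>n ln n / (ln n - ln k)\<close>, so that \<open>k + u + v\<close> is
  close to \<open>(1 + 1 / k) n\<close>. Counting elements shows that the degree is at least \<open>n\<close>.
\<close>

section \<open>Preliminaries on injections and on the variant operation\<close>

text \<open>The base point matters because an embedding may separate maps freely, except at constant
  maps, whose images are forced by the products.\<close>

lemma pointed_injection_exists:
  assumes "finite A" "finite B" "card A \<le> card B" "a \<in> A" "b \<in> B"
  shows "\<exists>f. inj_on f A \<and> f ` A \<subseteq> B \<and> f a = b"
proof -
  have "card (A - {a}) \<le> card (B - {b})"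
    using assms by simp
  then obtain f where f: "f ` (A - {a}) \<subseteq> B - {b}" "inj_on f (A - {a})"
    using card_le_inj[of "A - {a}" "B - {b}"] assms by auto
  have "inj_on (f(a := b)) A"
    using f by (auto simp: inj_on_def)
  moreover have "f(a := b) ` A \<subseteq> B"
    using f assms by auto
  ultimately show ?thesis
    by (intro exI[of _ "f(a := b)"]) auto
qed

lemma carrier_full_transf: "carrier (full_transf n) = {1..n} \<rightarrow>\<^sub>E {1..n}"
  by (simp add: full_transf_def)

lemma mult_full_transf: "f \<otimes>\<^bsub>full_transf n\<^esub> g = compose {1..n} g f"
  by (simp add: full_transf_def)

lemma carrier_variant: "carrier (variant n a) = {1..n} \<rightarrow>\<^sub>E {1..n}"
  by (simp add: variant_def full_transf_def)

lemma mult_variant_const: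
  assumes "a ` {1..n} = {c}" "f \<in> {1..n} \<rightarrow>\<^sub>E {1..n}"
  shows "f \<otimes>\<^bsub>variant n a\<^esub> g = (\<lambda>x\<in>{1..n}. g c)"
proof -
  have "a (f x) = c" if "x \<in> {1..n}" for x
    using assms that by blast
  then show ?thesis
    by (auto simp: variant_def full_transf_def compose_def restrict_def fun_eq_iff)
qed

text \<open>A map with a prescribed value at \<open>c\<close> is determined by its restriction to
  the other \<open>n - 1\<close> points. Equality fails for \<open>i\<close> outside
  \<open>{1..n}\<close>, where no such map exists.\<close>

lemma card_transf_fixed_value:
  assumes "c \<in> {1..n}"
  shows "card {g \<in> {1..n} \<rightarrow>\<^sub>E {1..n}. g c = i} \<le> n ^ (n - 1)"
proof -
  let ?D = "{1..n} - {c}"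
  have "inj_on (\<lambda>g. restrict g ?D) {g \<in> {1..n} \<rightarrow>\<^sub>E {1..n}. g c = i}"
  proof (rule inj_onI)
    fix g h
    assume g: "g \<in> {g \<in> {1..n} \<rightarrow>\<^sub>E {1..n}. g c = i}"
      and h: "h \<in> {g \<in> {1..n} \<rightarrow>\<^sub>E {1..n}. g c = i}"
      and eq: "restrict g ?D = restrict h ?D"
    show "g = h"
    proof (rule PiE_ext)
      show "g \<in> {1..n} \<rightarrow>\<^sub>E {1..n}" "h \<in> {1..n} \<rightarrow>\<^sub>E {1..n}"
        using g h by auto
      show "g x = h x" if "x \<in> {1..n}" for x
        using g h that fun_cong[OF eq, of x] by (cases "x = c") auto
    qed
  qed
  moreover have "(\<lambda>g. restrict g ?D) ` {g \<in> {1..n} \<rightarrow>\<^sub>E {1..n}. g c = i} \<subseteq> ?D \<rightarrow>\<^sub>E {1..n}"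
    by (intro image_subsetI restrict_PiE_iff[THEN iffD2]) blast
  ultimately have "card {g \<in> {1..n} \<rightarrow>\<^sub>E {1..n}. g c = i} \<le> card (?D \<rightarrow>\<^sub>E {1..n})"
    by (intro card_inj_on_le) (auto intro!: finite_PiE)
  also have "\<dots> = n ^ (n - 1)"
    using assms by (simp add: card_PiE)
  finally show ?thesis .
qed

section \<open>Construction of a small embedding\<close>

text \<open>Every product is a constant map \<open>e (g c)\<close>. Since \<open>\<phi> f\<close>
  preserves the first block and sends the other two into \<open>U\<close>, applying
  \<open>\<phi> g\<close> afterwards yields only \<open>\<alpha> (g c)\<close> and
  \<open>\<beta> (g c)\<close>. This composite is \<open>\<phi> (e (g c))\<close> as soon as
  \<open>\<phi> (e i)\<close> is constantly \<open>\<beta> i\<close> on \<open>V\<close>.\<close>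

lemma variant_embeds:
  assumes a: "a ` {1..n} = {c}" and c: "c \<in> {1..n}"
    and k: "k \<ge> 1" and nku: "n \<le> k * u" and pow: "n ^ (n - 1) \<le> u ^ v"
  shows "mon (variant n a) (full_transf (k + u + v)) \<noteq> {}"
proof -
  define T where "T = {1..n} \<rightarrow>\<^sub>E {1..n}"
  define C where "C i = {g \<in> T. g c = i}" for i
  define e where "e i = (\<lambda>x\<in>{1..n}. i)" for i :: nat
  define U where "U = {k + 1..k + u}"
  define V where "V = {k + u + 1..k + u + v}"
  \<comment> \<open>Remainder and quotient of \<open>i - 1\<close> by \<open>k\<close>, shifted into
    the first block and into \<open>U\<close>; together they determine \<open>i\<close>, and
    \<open>n \<le> k * u\<close> keeps the quotient below \<open>u\<close>.\<close>
  define \<alpha> where "\<alpha> i = 1 + (i - 1) mod k" for i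
  define \<beta> where "\<beta> i = k + 1 + (i - 1) div k" for i
  have finT: "finite T"
    unfolding T_def by (intro finite_PiE) auto
  have \<alpha>: "\<alpha> i \<in> {1..k}" for i
    using k by (simp add: \<alpha>_def Suc_le_eq)
  have \<beta>: "\<beta> i \<in> U" if "i \<in> {1..n}" for i
  proof -
    have "i - 1 < u * k"
      using that nku by (simp add: mult.commute) linarith
    then have "(i - 1) div k < u"
      by (rule less_mult_imp_div_less)
    then show ?thesis
      by (simp add: \<beta>_def U_def)
  qed
  have \<alpha>\<beta>: "i = j" if "i \<in> {1..n}" "j \<in> {1..n}" "\<alpha> i = \<alpha> j" "\<beta> i = \<beta> j" for i j
  proof -
    have "(i - 1) mod k = (j - 1) mod k" "(i - 1) div k = (j - 1) div k"
      using that by (auto simp: \<alpha>_def \<beta>_def)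
    then have "i - 1 = j - 1"
      by (metis div_mult_mod_eq)
    then show ?thesis
      using that by auto
  qed
  have eC: "e i \<in> C i" if "i \<in> {1..n}" for i
    using that c by (auto simp: e_def C_def T_def)
  \<comment> \<open>The prescribed value at \<open>e i\<close> makes \<open>V\<close> behave like
    \<open>U\<close> for products.\<close>
  have "\<exists>f. inj_on f (C i) \<and> f ` C i \<subseteq> V \<rightarrow>\<^sub>E U \<and> f (e i) = (\<lambda>x\<in>V. \<beta> i)"
    if i: "i \<in> {1..n}" for i
  proof (rule pointed_injection_exists)
    show "finite (C i)"
      using finT by (simp add: C_def)
    show "finite (V \<rightarrow>\<^sub>E U)"
      by (auto simp: U_def V_def intro!: finite_PiE)
    have "card (C i) \<le> n ^ (n - 1)"
      unfolding C_def T_def by (rule card_transf_fixed_value[OF c])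
    also note pow
    also have "u ^ v = card (V \<rightarrow>\<^sub>E U)"
      by (simp add: card_PiE U_def V_def)
    finally show "card (C i) \<le> card (V \<rightarrow>\<^sub>E U)" .
    show "e i \<in> C i"
      by (rule eC[OF i])
    show "(\<lambda>x\<in>V. \<beta> i) \<in> V \<rightarrow>\<^sub>E U"
      using \<beta>[OF i] by auto
  qed
  then obtain \<iota> where \<iota>: "\<And>i. i \<in> {1..n} \<Longrightarrow> inj_on (\<iota> i) (C i)"
      "\<And>i. i \<in> {1..n} \<Longrightarrow> \<iota> i ` C i \<subseteq> V \<rightarrow>\<^sub>E U"
      "\<And>i. i \<in> {1..n} \<Longrightarrow> \<iota> i (e i) = (\<lambda>x\<in>V. \<beta> i)"
    by metis
  define \<phi> where "\<phi> g = (\<lambda>x\<in>{1..k + u + v}.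
      if x \<le> k then \<alpha> (g c) else if x \<le> k + u then \<beta> (g c) else \<iota> (g c) g x)" for g
  have gc: "g c \<in> {1..n}" "g \<in> C (g c)" if "g \<in> T" for g
    using that c by (auto simp: T_def C_def)
  have \<phi>A: "\<phi> g x = \<alpha> (g c)" if "x \<in> {1..k}" for g x
    using that by (simp add: \<phi>_def)
  have \<phi>U: "\<phi> g x = \<beta> (g c)" if "x \<in> U" for g x
    using that by (simp add: \<phi>_def U_def)
  have \<phi>V: "\<phi> g x = \<iota> (g c) g x" if "x \<in> V" for g x
    using that by (simp add: \<phi>_def V_def)
  have dom: "{1..k + u + v} = {1..k} \<union> U \<union> V"
    by (auto simp: U_def V_def)
  have \<phi>_in_A: "\<phi> g x \<in> {1..k}" if "x \<in> {1..k}" for g x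
    using that \<alpha> by (simp only: \<phi>A)
  have \<phi>_in_U: "\<phi> g x \<in> U" if "g \<in> T" "x \<in> U \<union> V" for g x
  proof (cases "x \<in> U")
    case True
    then show ?thesis
      using \<beta>[OF gc(1)[OF that(1)]] by (simp only: \<phi>U)
  next
    case False
    then have x: "x \<in> V"
      using that(2) by blast
    have "\<iota> (g c) g \<in> V \<rightarrow>\<^sub>E U"
      using \<iota>(2)[OF gc(1)[OF that(1)]] gc(2)[OF that(1)] by blast
    then show ?thesis
      using x by (simp only: \<phi>V) blast
  qed
  have "\<phi> \<in> hom (variant n a) (full_transf (k + u + v))"
  proof (rule homI)
    fix g assume "g \<in> carrier (variant n a)"
    then have g: "g \<in> T"
      by (simp add: carrier_variant T_def)
    have "\<phi> g x \<in> {1..k + u + v}" if "x \<in> {1..k + u + v}" for x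
      using that \<phi>_in_A[of x g] \<phi>_in_U[OF g, of x] unfolding dom by blast
    then show "\<phi> g \<in> carrier (full_transf (k + u + v))"
      unfolding carrier_full_transf by (intro PiE_I) (auto simp: \<phi>_def)
  next
    fix f g assume "f \<in> carrier (variant n a)" "g \<in> carrier (variant n a)"
    then have f: "f \<in> T" and g: "g \<in> T"
      by (simp_all add: carrier_variant T_def)
    have fg: "f \<otimes>\<^bsub>variant n a\<^esub> g = e (g c)"
      using mult_variant_const[OF a] f by (simp add: T_def e_def)
    have ec: "e (g c) c = g c"
      using c by (simp add: e_def)
    have "\<phi> (e (g c)) x = \<phi> g (\<phi> f x)" if "x \<in> {1..k + u + v}" for x
    proof (cases "x \<in> {1..k}")
      case True
      then show ?thesis
        using \<phi>_in_A[OF True, of f] by (simp only: \<phi>A ec)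
    next
      case False
      then have x: "x \<in> U \<union> V"
        using that dom by blast
      then have "\<phi> (e (g c)) x = \<beta> (g c)"
        using \<iota>(3)[OF gc(1)[OF g]] by (auto simp: \<phi>U \<phi>V ec)
      then show ?thesis
        using \<phi>_in_U[OF f x] by (simp only: \<phi>U)
    qed
    then show "\<phi> (f \<otimes>\<^bsub>variant n a\<^esub> g) = \<phi> f \<otimes>\<^bsub>full_transf (k + u + v)\<^esub> \<phi> g"
      unfolding fg mult_full_transf compose_def
      by (auto simp: fun_eq_iff restrict_def \<phi>_def)
  qed
  moreover have "inj_on \<phi> (carrier (variant n a))"
  proof (rule inj_onI)
    fix f g assume "f \<in> carrier (variant n a)" "g \<in> carrier (variant n a)" and eq: "\<phi> f = \<phi> g"
    then have f: "f \<in> T" and g: "g \<in> T"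
      by (simp_all add: carrier_variant T_def)
    have 1: "1 \<in> {1..k}"
      using k by simp
    \<comment> \<open>\<open>U\<close> is nonempty because it contains
      \<open>\<beta> c\<close>.\<close>
    have 2: "k + 1 \<in> U"
      using \<beta>[OF c] by (auto simp: U_def)
    have fgc: "f c = g c"
      using \<alpha>\<beta>[OF gc(1)[OF f] gc(1)[OF g]] \<phi>A[OF 1, of f] \<phi>A[OF 1, of g]
        \<phi>U[OF 2, of f] \<phi>U[OF 2, of g] eq by simp
    have "\<iota> (g c) f = \<iota> (g c) g"
    proof (rule PiE_ext)
      show "\<iota> (g c) f \<in> V \<rightarrow>\<^sub>E U" "\<iota> (g c) g \<in> V \<rightarrow>\<^sub>E U"
        using \<iota>(2)[OF gc(1)[OF g]] gc(2)[OF f] gc(2)[OF g] fgc by auto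
      show "\<iota> (g c) f x = \<iota> (g c) g x" if "x \<in> V" for x
        using \<phi>V[OF that, of f] \<phi>V[OF that, of g] eq fgc by simp
    qed
    then show "f = g"
      using \<iota>(1)[OF gc(1)[OF g]] gc(2)[OF f] gc(2)[OF g] fgc by (auto simp: inj_on_def)
  qed
  ultimately show ?thesis
    by (auto simp: mon_def)
qed

section \<open>Bounds on the degree\<close>

text \<open>Injectivity alone gives \<open>n ^ n \<le> m ^ m\<close>.\<close>

lemma variant_embeds_imp_le:
  assumes "1 \<le> m" "mon (variant n a) (full_transf m) \<noteq> {}"
  shows "n \<le> m"
proof (rule ccontr)
  assume "\<not> n \<le> m"
  obtain h where "h \<in> hom (variant n a) (full_transf m)" "inj_on h (carrier (variant n a))"
    using assms(2) by (auto simp: mon_def)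
  then have "card ({1..n} \<rightarrow>\<^sub>E {1..n}) \<le> card ({1..m} \<rightarrow>\<^sub>E {1..m})"
    by (intro card_inj_on_le[of h])
       (auto simp: hom_def carrier_variant carrier_full_transf intro!: finite_PiE)
  then have "n ^ n \<le> m ^ m"
    by (simp add: card_PiE)
  also have "m ^ m \<le> n ^ m"
    using \<open>\<not> n \<le> m\<close> by (intro power_mono) auto
  finally show False
    \<comment> \<open>From \<open>n > m\<close> and \<open>m \<ge> 1\<close> follows
      \<open>n > 1\<close>, so powers of \<open>n\<close> increase strictly with the
      exponent.\<close>
    using \<open>\<not> n \<le> m\<close> assms(1) power_increasing_iff[of n n m] by linarith
qed

lemma variant_degree_bounds:
  assumes "a \<in> carrier (full_transf n)" "transf_rank n a = 1"
    and "k \<ge> 1" "n \<le> k * u" "n ^ (n - 1) \<le> u ^ v"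
  shows "n \<le> semigroup_degree (variant n a)" "semigroup_degree (variant n a) \<le> k + u + v"
proof -
  obtain c where c: "a ` {1..n} = {c}"
    using assms(2) by (auto simp: transf_rank_def card_1_singleton_iff)
  moreover have "a ` {1..n} \<subseteq> {1..n}"
    using assms(1) unfolding carrier_full_transf by blast
  ultimately have "c \<in> {1..n}"
    by blast
  then have emb: "1 \<le> k + u + v \<and> mon (variant n a) (full_transf (k + u + v)) \<noteq> {}"
    using variant_embeds[OF c] assms by auto
  then show "semigroup_degree (variant n a) \<le> k + u + v"
    unfolding semigroup_degree_def by (rule Least_le)
  \<comment> \<open>The embedding \<open>emb\<close> guarantees that the \<open>LEAST\<close> is
    attained, so the counting bound applies to it.\<close>
  show "n \<le> semigroup_degree (variant n a)"
    using LeastI[of "\<lambda>m. 1 \<le> m \<and> mon (variant n a) (full_transf m) \<noteq> {}", OF emb]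
    unfolding semigroup_degree_def by (blast intro: variant_embeds_imp_le)
qed

section \<open>Choice of the parameters and asymptotics\<close>

text \<open>In logarithms: \<open>ln u\<close> is at least \<open>ln n - ln k > 0\<close>, so this
  exponent makes \<open>v * ln u\<close> at least \<open>n * ln n\<close>. This gives even
  \<open>n ^ n \<le> u ^ v\<close>.\<close>

lemma power_le_power_ceiling:
  fixes n k u :: nat
  assumes "k \<ge> 1" "n > k" "real n / real k \<le> real u"
  shows "n ^ (n - 1) \<le> u ^ nat \<lceil>real n * ln (real n) / (ln (real n) - ln (real k))\<rceil>"
    (is "_ \<le> u ^ ?v")
proof -
  have pos: "ln (real n) - ln (real k) > 0"
    using assms by simp
  have upos: "real u > 0"
    using assms by (intro less_le_trans[OF _ assms(3)]) auto
  have "ln (real n) - ln (real k) = ln (real n / real k)"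
    using assms by (simp add: ln_div)
  also have "\<dots> \<le> ln (real u)"
    using assms upos by (subst ln_le_cancel_iff) auto
  finally have lnu: "ln (real n) - ln (real k) \<le> ln (real u)" .
  have "real n * ln (real n) = real n * ln (real n) / (ln (real n) - ln (real k)) * (ln (real n) - ln (real k))"
    using pos by simp
  also have "\<dots> \<le> real ?v * ln (real u)"
    using lnu pos by (intro mult_mono real_nat_ceiling_ge) auto
  finally have "ln (real n ^ n) \<le> ln (real u ^ ?v)"
    using assms upos by (simp add: ln_realpow)
  then have "real n ^ n \<le> real u ^ ?v"
    using assms upos by (subst (asm) ln_le_cancel_iff) auto
  then have "real (n ^ n) \<le> real (u ^ ?v)"
    by simp
  then have "n ^ n \<le> u ^ ?v"
    by (simp only: of_nat_le_iff)
  moreover have "n ^ (n - 1) \<le> n ^ n"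
    using assms by (intro power_increasing) auto
  ultimately show ?thesis
    by linarith
qed

text \<open>The two \<open>+ 1\<close> pay for rounding \<open>u\<close> and \<open>v\<close> to
  integers. As \<open>ln n / (ln n - ln k)\<close> tends to 1, the left side grows like
  \<open>(1 + 1 / k) * n\<close>.\<close>

lemma degree_bound_asymptotics:
  fixes k :: nat
  assumes "k \<ge> 1" "1 + 1 / real k < x"
  shows "\<forall>\<^sub>F n in at_top. real k + (real n / real k + 1) +
           (real n * ln (real n) / (ln (real n) - ln (real k)) + 1) \<le> x * real n"
proof -
  define K where "K = real k"
  \<comment> \<open>The slack of \<open>x\<close> over the leading coefficient
    \<open>1 + 1 / k\<close>.\<close>
  define d where "d = x - 1 - 1 / K"
  have K: "K > 0" and d: "d > 0"
    using assms by (auto simp: K_def d_def)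
  have "((\<lambda>n. (K + 2 + real n * ln (real n) / (ln (real n) - ln K)) / real n) \<longlongrightarrow> 1) at_top"
    using K by real_asymp
  then have "\<forall>\<^sub>F n in at_top. (K + 2 + real n * ln (real n) / (ln (real n) - ln K)) / real n < 1 + d"
    by (rule order_tendstoD) (use d in simp)
  then show ?thesis
    using eventually_gt_at_top[of 0]
  proof eventually_elim
    case (elim n)
    then have "K + 2 + real n * ln (real n) / (ln (real n) - ln K) < (1 + d) * real n"
      by (simp add: pos_divide_less_eq)
    also have "\<dots> = x * real n - real n / K"
      by (simp add: d_def algebra_simps)
    finally show ?case
      by (simp add: K_def)
  qed
qed

theorem theorem5p27:
  fixes a :: "nat \<Rightarrow> nat \<Rightarrow> nat" and \<mu> :: "nat \<Rightarrow> nat"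
  assumes a: "\<And>n. n \<ge> 1 \<Longrightarrow> a n \<in> carrier (full_transf n) \<and> transf_rank n (a n) = 1"
    and \<mu>: "\<And>n. n \<ge> 1 \<Longrightarrow> \<mu> n = semigroup_degree (variant n (a n))"
  shows "(\<forall>x::real. 1 < x \<and> x < 2 \<longrightarrow> (\<exists>N::nat. \<forall>n>N. real (\<mu> n) \<le> x * real n))
    \<and> (\<lambda>n. real (\<mu> n)) \<sim>[at_top] (\<lambda>n. real n)"
proof -
  \<comment> \<open>Both claims follow from this, by letting \<open>x\<close> vary.\<close>
  have bounds: "\<forall>\<^sub>F n in at_top. n \<le> \<mu> n \<and> real (\<mu> n) \<le> x * real n" if "x > 1" for x :: real
  proof -
    obtain k0 :: nat where k0: "1 / (x - 1) < real k0"
      using reals_Archimedean2 by blast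
    then have "0 < real k0"
      using that by (intro less_trans[OF _ k0]) simp
    then have k: "k0 \<ge> 1" "1 + 1 / real k0 < x"
      using k0 that by (auto simp: field_simps)
    show ?thesis
      using degree_bound_asymptotics[OF k] eventually_gt_at_top[of k0]
    proof eventually_elim
      case (elim n)
      \<comment> \<open>Rounds \<open>n / k0\<close> up strictly, by at most 1.\<close>
      define u where "u = n div k0 + 1"
      define w where "w = real n * ln (real n) / (ln (real n) - ln (real k0))"
      define v where "v = nat \<lceil>w\<rceil>"
      have nk: "n \<le> k0 * u"
        using k(1) unfolding u_def
        by (metis add.commute dividend_less_times_div less_imp_le_nat less_le_trans mult_Suc_right
            plus_1_eq_Suc zero_less_one)
      then have "real n \<le> real k0 * real u"
        by (metis of_nat_le_iff of_nat_mult)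
      then have "real n / real k0 \<le> real u"
        using k(1) by (simp add: field_simps)
      then have pow: "n ^ (n - 1) \<le> u ^ v"
        using power_le_power_ceiling k(1) elim(2) by (simp add: v_def w_def)
      have n: "n \<ge> 1"
        using elim(2) by simp
      have le: "n \<le> \<mu> n" and "\<mu> n \<le> k0 + u + v"
        using variant_degree_bounds[of "a n" n k0 u v] a[OF n] k(1) nk pow \<mu>[OF n] by auto
      then have "real (\<mu> n) \<le> real k0 + real u + real v"
        by linarith
      moreover have "real u \<le> real n / real k0 + 1"
        by (simp add: u_def of_nat_div_le_of_nat)
      \<comment> \<open>Ensures that \<open>nat\<close> does not cut off a negative ceiling.\<close>
      moreover have "w \<ge> 0"
        using elim(2) k(1) by (simp add: w_def)
      then have "real v \<le> w + 1"
        unfolding v_def by linarith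
      ultimately show ?case
        using elim(1) le by (simp add: w_def)
    qed
  qed
  have "\<exists>N. \<forall>n>N. real (\<mu> n) \<le> x * real n" if "1 < x" for x :: real
    using bounds[OF that] by (auto simp: eventually_at_top_linorder intro: less_imp_le)
  moreover have "(\<lambda>n. real (\<mu> n)) \<sim>[at_top] (\<lambda>n. real n)"
  proof (rule asymp_equivI'[OF order_tendstoI])
    fix y :: real assume "y < 1"
    show "\<forall>\<^sub>F n in at_top. y < real (\<mu> n) / real n"
      \<comment> \<open>The lower bound comes from \<open>n \<le> \<mu> n\<close>; 2 is just some
        value above 1.\<close>
      using bounds[of 2, simplified] eventually_gt_at_top[of 0]
    proof eventually_elim
      case (elim n)
      then have "1 \<le> real (\<mu> n) / real n"
        by simp
      with \<open>y < 1\<close> show ?case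
        by linarith
    qed
  next
    fix y :: real assume "1 < y"
    \<comment> \<open>The midpoint leaves room to turn the weak bound into a strict one.\<close>
    then have "1 < (1 + y) / 2"
      by simp
    from bounds[OF this] show "\<forall>\<^sub>F n in at_top. real (\<mu> n) / real n < y"
      using eventually_gt_at_top[of 0]
    proof eventually_elim
      case (elim n)
      then have "real (\<mu> n) / real n \<le> (1 + y) / 2"
        by (simp add: pos_divide_le_eq)
      also have "\<dots> < y"
        using \<open>1 < y\<close> by simp
      finally show ?case .
    qed
  qed
  ultimately show ?thesis
    by blast
qed

end
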